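(* Let $\alpha,\beta>0$ and $b<c$. Let $V\in L^\infty(\mathbb{R})$ satisfy $V(x)\ge\alpha$ for a.e. $x\in(-\infty,b)\cup(c,\infty)$ and $V(x)=-\beta$ for $x\in(b,c)$. If $\sqrt{\beta}\,(c-b)\ge\pi$, then there exists $a\in[b,c]$ such that $F(a;V)=m(V)$.
   Context: Elements of $H^1(\mathbb{R})$ are identified with their continuous representatives; $\|u\|_\infty:=\|u\|_{L^\infty(\mathbb{R})}$. For $V\in L^\infty(\mathbb{R})$ and $u\in H^1(\mathbb{R})$ set $I(u;V):=\|u'\|_{L^2(\mathbb{R})}^2+\int_{\mathbb{R}}V|u|^2\,dx$ and $m(V):=\inf_{u\in H^1(\mathbb{R}),\,u\not\equiv0} I(u;V)/\|u\|_\infty^2$. For $a\in\mathbb{R}$, $K_a:=\{u\in H^1(\mathbb{R}):u(a)=\|u\|_\infty=1\}$ and $F(a;V):=\inf_{u\in K_a}I(u;V)$. *)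

theory Defs
  imports "HOL-Analysis.Analysis"
begin

text \<open>Functions are complex valued. \<open>g\<close> is a weak derivative of \<open>u\<close> in the H^1 sense:
  u, g are measurable and square integrable on the real line and u is the
  (absolutely continuous) primitive of g.\<close>
definition H1_deriv :: "(real \<Rightarrow> complex) \<Rightarrow> (real \<Rightarrow> complex) \<Rightarrow> bool" where
  "H1_deriv u g \<longleftrightarrow>
     u \<in> borel_measurable lborel \<and> integrable lborel (\<lambda>x. (cmod (u x))^2) \<and>
     g \<in> borel_measurable lborel \<and> integrable lborel (\<lambda>x. (cmod (g x))^2) \<and>
     (\<forall>x y. x \<le> y \<longrightarrow> (g has_integral (u y - u x)) {x..y})"

definition H1 :: "(real \<Rightarrow> complex) set" where
  "H1 = {u. \<exists>g. H1_deriv u g}"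

definition wderiv :: "(real \<Rightarrow> complex) \<Rightarrow> real \<Rightarrow> complex" where
  "wderiv u = (SOME g. H1_deriv u g)"

definition Linfty :: "(real \<Rightarrow> real) set" where
  "Linfty = {V. V \<in> borel_measurable lborel \<and> (\<exists>M. AE x in lborel. \<bar>V x\<bar> \<le> M)}"

definition supnorm :: "(real \<Rightarrow> complex) \<Rightarrow> real" where
  "supnorm u = (SUP x. cmod (u x))"

definition Ifun :: "(real \<Rightarrow> complex) \<Rightarrow> (real \<Rightarrow> real) \<Rightarrow> real" where
  "Ifun u V = (\<integral>x. (cmod (wderiv u x))^2 \<partial>lborel) + (\<integral>x. V x * (cmod (u x))^2 \<partial>lborel)"

definition mV :: "(real \<Rightarrow> real) \<Rightarrow> real" where
  "mV V = (INF u \<in> {u \<in> H1. u \<noteq> (\<lambda>_. 0)}. Ifun u V / (supnorm u)^2)"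

definition Kset :: "real \<Rightarrow> (real \<Rightarrow> complex) set" where
  "Kset a = {u \<in> H1. u a = 1 \<and> supnorm u = 1}"

definition Ffun :: "real \<Rightarrow> (real \<Rightarrow> real) \<Rightarrow> real" where
  "Ffun a V = (INF u \<in> Kset a. Ifun u V)"

end

theory Submission
  imports Defs
begin

text \<open>
  With \<open>k = sqrt \<beta>\<close>, the midpoint \<open>a\<close> of \<open>[b, c]\<close> always works. Given \<open>u\<close> with \<open>|u| \<le> 1\<close>, on \<open>[b, a]\<close> the
  energy of \<open>|u'|\<^sup>2 - k\<^sup>2 |u|\<^sup>2\<close> with prescribed \<open>|u b| = cos \<theta>\<close> under the constraint \<open>|u| \<le> 1\<close> is minimised
  by the arc \<open>cos (\<theta> - k (x - b))\<close>, which reaches \<open>1\<close> with zero slope at \<open>b + \<theta> / k \<le> b + pi / (2 k) \<le> a\<close>,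
  continued by the constant \<open>1\<close>. Replacing \<open>u\<close> by this profile on \<open>[b, a]\<close>, symmetrically on \<open>[a, c]\<close>,
  and rotating its phase on each outer half-line so that the values match, gives a function with
  value \<open>1\<close> at \<open>a\<close> and no larger energy, whatever \<open>V\<close> is outside \<open>(b, c)\<close>.
\<close>

section \<open>Product rule for functions known only as primitives\<close>

lemma continuous_on_primitive:
  fixes g :: "real \<Rightarrow> 'a::banach"
  assumes "a \<le> b" and "\<And>t. a \<le> t \<Longrightarrow> t \<le> b \<Longrightarrow> (g has_integral U t - U a) {a..t}"
  shows "continuous_on {a..b} U"
proof -
  have "g integrable_on {a..b}" using assms by blast
  then have "continuous_on {a..b} (\<lambda>x. U a + integral {a..x} g)"
    by (intro continuous_intros indefinite_integral_continuous_1)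
  moreover have "U a + integral {a..t} g = U t" if "t \<in> {a..b}" for t
    using integral_unique[OF assms(2)[of t]] that by simp
  ultimately show ?thesis by (rule continuous_on_eq)
qed

text \<open>Integration by parts without pointwise derivatives. The defect \<open>D\<close> of the
  product rule is additive over adjacent intervals and, on short intervals, is at most
  \<open>e\<close> times the integral of a fixed function \<open>G\<close>. Bisection carries this
  bound to \<open>{a..b}\<close>, and \<open>e\<close> tends to 0.\<close>

lemma bilinear_indefinite_integral:
  fixes g :: "real \<Rightarrow> 'a::euclidean_space" and h :: "real \<Rightarrow> 'b::euclidean_space"
    and prod :: "'a \<Rightarrow> 'b \<Rightarrow> 'c::euclidean_space"
  assumes bil: "bounded_bilinear prod" and ab: "a \<le> b"
    and g: "g absolutely_integrable_on {a..b}" and h: "h absolutely_integrable_on {a..b}"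
    and U: "\<And>s t. a \<le> s \<Longrightarrow> s \<le> t \<Longrightarrow> t \<le> b \<Longrightarrow> (g has_integral U t - U s) {s..t}"
    and H: "\<And>s t. a \<le> s \<Longrightarrow> s \<le> t \<Longrightarrow> t \<le> b \<Longrightarrow> (h has_integral H t - H s) {s..t}"
  defines "F \<equiv> \<lambda>x. prod (U x) (h x) + prod (g x) (H x)"
  shows "F absolutely_integrable_on {a..b}"
    and "(F has_integral (prod (U b) (H b) - prod (U a) (H a))) {a..b}"
proof -
  interpret bounded_bilinear prod by (rule bil)
  have contU: "continuous_on {a..b} U" and contH: "continuous_on {a..b} H"
    using U[of a] H[of a] ab by (auto intro: continuous_on_primitive)
  have bil': "bilinear prod" "bilinear (\<lambda>x y. prod y x)"
    using bil flip by (simp_all add: bilinear_conv_bounded_bilinear)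
  have meas: "f \<in> borel_measurable (lebesgue_on {a..b})" "bounded (f ` {a..b})"
    if "continuous_on {a..b} f" for f :: "real \<Rightarrow> 'd::euclidean_space"
    using that by (auto intro: continuous_imp_measurable_on_sets_lebesgue compact_imp_bounded compact_continuous_image)
  have "(\<lambda>x. prod (U x) (h x)) absolutely_integrable_on {a..b}"
    "(\<lambda>x. prod (g x) (H x)) absolutely_integrable_on {a..b}"
    using absolutely_integrable_bounded_measurable_product[OF bil'(1) meas(1)[OF contU] _ meas(2)[OF contU] h]
      absolutely_integrable_bounded_measurable_product[OF bil'(2) meas(1)[OF contH] _ meas(2)[OF contH] g]
    by simp_all
  then show ai: "F absolutely_integrable_on {a..b}"
    unfolding F_def by (rule set_integral_add)
  then have Fi: "F integrable_on {a..b}"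
    by (simp add: absolutely_integrable_on_def)
  obtain K where K: "0 \<le> K" "\<And>x y. norm (prod x y) \<le> norm x * norm y * K"
    using nonneg_bounded by blast
  define G where "G = (\<lambda>x. (norm (h x) + norm (g x)) * K)"
  have Gi: "G integrable_on {a..b}"
    unfolding G_def using g h by (auto simp: absolutely_integrable_on_def intro!: integrable_on_mult_left integrable_add)
  define D where "D = (\<lambda>s t. prod (U t) (H t) - prod (U s) (H s) - integral {s..t} F)"
  have main: "norm (D a b) \<le> e * integral {a..b} G" if e: "e > 0" for e
  proof -
    \<comment> \<open>The guard is there because the local clause of \<open>Bolzano\<close> also
      meets intervals that stick out of \<open>{a..b}\<close>.\<close>
    define P where "P = (\<lambda>s t. a \<le> s \<and> s \<le> t \<and> t \<le> b \<longrightarrow> norm (D s t) \<le> e * integral {s..t} G)"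
    from ab have "P a b"
    proof (induction rule: Bolzano)
      case (trans r s t)
      show ?case unfolding P_def
      proof
        assume A: "a \<le> r \<and> r \<le> t \<and> t \<le> b"
        have i: "F integrable_on {r..t}" "G integrable_on {r..t}"
          using A integrable_subinterval_real[OF Fi, of r t] integrable_subinterval_real[OF Gi, of r t] by auto
        have "integral {r..t} G = integral {r..s} G + integral {s..t} G"
          "integral {r..t} F = integral {r..s} F + integral {s..t} F"
          using i trans by (simp_all add: Henstock_Kurzweil_Integration.integral_combine)
        moreover have "norm (D r s) \<le> e * integral {r..s} G" "norm (D s t) \<le> e * integral {s..t} G"
          using trans A by (auto simp: P_def)
        moreover have "D r t = D r s + D s t" using calculation by (simp add: D_def)
        ultimately show "norm (D r t) \<le> e * integral {r..t} G"
          by (metis (no_types, opaque_lifting) add_mono distrib_left norm_triangle_mono)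
      qed
    next
      case (local x)
      obtain d1 where d1: "d1 > 0" "\<And>y. y \<in> {a..b} \<Longrightarrow> dist y x < d1 \<Longrightarrow> dist (U y) (U x) < e/2"
        using contU local e unfolding continuous_on_iff by (metis atLeastAtMost_iff half_gt_zero)
      obtain d2 where d2: "d2 > 0" "\<And>y. y \<in> {a..b} \<Longrightarrow> dist y x < d2 \<Longrightarrow> dist (H y) (H x) < e/2"
        using contH local e unfolding continuous_on_iff by (metis atLeastAtMost_iff half_gt_zero)
      have "P s t" if st: "s \<le> x" "x \<le> t" "t - s < min d1 d2" for s t
        unfolding P_def
      proof
        assume A: "a \<le> s \<and> s \<le> t \<and> t \<le> b"
        have osc: "norm (U t - U y) \<le> e" "norm (H s - H y) \<le> e" if "y \<in> {s..t}" for y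
        proof -
          have "dist (U t) (U x) < e/2" "dist (U y) (U x) < e/2" "dist (H s) (H x) < e/2" "dist (H y) (H x) < e/2"
            by (rule d1(2) d2(2); use st A that in \<open>auto simp: dist_real_def\<close>)+
          then show "norm (U t - U y) \<le> e" "norm (H s - H y) \<le> e"
            using dist_triangle_half_r[of "U x" "U t" e "U y"] dist_triangle_half_r[of "H x" "H s" e "H y"]
            by (auto simp: dist_norm norm_minus_commute)
        qed
        have i: "F integrable_on {s..t}" "G integrable_on {s..t}"
          using A integrable_subinterval_real[OF Fi, of s t] integrable_subinterval_real[OF Gi, of s t] by auto
        \<comment> \<open>The increment of the product is
          \<open>prod (U t) (H t - H s) + prod (U t - U s) (H s)\<close>. Each term is an integral
          with one factor frozen, so subtracting \<open>F\<close> leaves only the oscillations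
          \<open>U t - U y\<close> and \<open>H s - H y\<close>, both at most \<open>e\<close> near
          \<open>x\<close>.\<close>
        have 1: "((\<lambda>y. prod (U t) (h y)) has_integral prod (U t) (H t - H s)) {s..t}"
          using has_integral_linear[OF H bounded_linear_right] A by (auto simp: o_def)
        have 2: "((\<lambda>y. prod (g y) (H s)) has_integral prod (U t - U s) (H s)) {s..t}"
          using has_integral_linear[OF U bounded_linear_left] A by (auto simp: o_def)
        have "((\<lambda>y. prod (U t) (h y) + prod (g y) (H s) - F y) has_integral D s t) {s..t}"
          using has_integral_diff[OF has_integral_add[OF 1 2] integrable_integral[OF i(1)]]
          by (simp add: D_def diff_left diff_right)
        then have "((\<lambda>y. prod (U t - U y) (h y) + prod (g y) (H s - H y)) has_integral D s t) {s..t}"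
          by (simp add: F_def diff_left diff_right algebra_simps)
        moreover have "norm (prod (U t - U y) (h y) + prod (g y) (H s - H y)) \<le> e * G y"
          if "y \<in> {s..t}" for y
        proof -
          have "norm (prod (U t - U y) (h y)) \<le> e * norm (h y) * K"
            by (rule order_trans[OF K(2)]) (intro mult_right_mono osc that K norm_ge_zero)
          moreover have "norm (prod (g y) (H s - H y)) \<le> norm (g y) * e * K"
            by (rule order_trans[OF K(2)]) (intro mult_right_mono mult_left_mono osc that K norm_ge_zero)
          ultimately show ?thesis
            using norm_triangle_ineq[of "prod (U t - U y) (h y)" "prod (g y) (H s - H y)"]
            by (simp add: G_def algebra_simps)
        qed
        moreover have "((\<lambda>y. e * G y) has_integral e * integral {s..t} G) {s..t}"
          using i by (intro has_integral_mult_right integrable_integral)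
        ultimately show "norm (D s t) \<le> e * integral {s..t} G"
          by (metis (no_types, lifting) has_integral_iff integral_norm_bound_integral)
      qed
      then show ?case using d1(1) d2(1) by (intro exI[of _ "min d1 d2"]) auto
    qed
    then show ?thesis using ab by (simp add: P_def)
  qed
  have "norm (D a b) \<le> 0"
  proof (rule field_le_epsilon)
    fix e :: real assume "e > 0"
    have G0: "0 \<le> integral {a..b} G" by (intro integral_nonneg Gi) (simp add: G_def K)
    \<comment> \<open>The summand 1 covers the case where the integral of \<open>G\<close> is
      zero.\<close>
    have "norm (D a b) \<le> e / (1 + integral {a..b} G) * integral {a..b} G"
      using main[of "e / (1 + integral {a..b} G)"] \<open>e > 0\<close> G0 by auto
    also have "\<dots> \<le> e" using \<open>e > 0\<close> G0 by (simp add: field_simps)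
    finally show "norm (D a b) \<le> 0 + e" by simp
  qed
  then have "integral {a..b} F = prod (U b) (H b) - prod (U a) (H a)" by (simp add: D_def)
  then show "(F has_integral (prod (U b) (H b) - prod (U a) (H a))) {a..b}"
    using integrable_integral[OF Fi] by simp
qed

section \<open>Uniqueness of weak derivatives\<close>

text \<open>Closed intervals generate the Borel sets, and sets with vanishing integral are closed
  under countable disjoint unions. The hypothesis on the total integral is what handles
  complements.\<close>

lemma AE_zero_of_interval_integrals:
  fixes f :: "real \<Rightarrow> complex"
  assumes f: "integrable lborel f" and int0: "(LINT y|lborel. f y) = 0"
    and I: "\<And>s t. s \<le> t \<Longrightarrow> (LINT y:{s..t}|lborel. f y) = 0"
  shows "AE x in lborel. f x = 0"
proof (rule sigma_finite_measure.density_zero[OF sigma_finite_lborel f])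
  have si: "set_integrable lborel A f" if "A \<in> sets borel" for A
    using f that unfolding set_integrable_def by (intro integrable_mult_indicator) auto
  fix A :: "real set" assume "A \<in> sets lborel"
  then have "A \<in> sets borel" by simp
  then show "(LINT y:A|lborel. f y) = 0"
  proof (induction rule: borel_set_induct)
    case (compl A)
    have "(LINT y:A \<union> (-A)|lborel. f y) = (LINT y:A|lborel. f y) + (LINT y:-A|lborel. f y)"
      using compl by (intro set_integral_Un si) auto
    then show ?case using compl int0 by (simp add: set_lebesgue_integral_def)
  next
    case (union A)
    have "(LINT x:(\<Union>i. A i)|lborel. f x) = (\<Sum>i. (LINT x:A i|lborel. f x))"
      using union by (intro lebesgue_integral_countable_add si) (auto simp: disjoint_family_on_def)
    then show ?case using union by simp
  qed (use I in \<open>auto simp: set_lebesgue_integral_def\<close>)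
qed

lemma set_integrable_Icc_of_square:
  fixes g :: "real \<Rightarrow> 'a::{banach, second_countable_topology}"
  assumes [measurable]: "g \<in> borel_measurable lborel" and i: "integrable lborel (\<lambda>x. (norm (g x))\<^sup>2)"
  shows "set_integrable lborel {a..b} g"
  unfolding set_integrable_def
proof (rule Bochner_Integration.integrable_bound)
  show "integrable lborel (\<lambda>x. indicator {a..b} x + (norm (g x))\<^sup>2)"
    using i by (intro Bochner_Integration.integrable_add integrable_real_indicator)
      (auto simp: emeasure_lborel_Icc_eq)
  have "t \<le> 1 + t\<^sup>2" for t :: real
    using sum_squares_bound[of t 1] zero_le_power2[of t] by (cases "t \<ge> 0") (simp, linarith)
  then show "AE x in lborel. norm (indicator {a..b} x *\<^sub>R g x) \<le> norm (indicator {a..b} x + (norm (g x))\<^sup>2)"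
    by (auto simp: indicator_def)
qed auto

lemma H1_deriv_set_integral:
  assumes "H1_deriv u g" "s \<le> t"
  shows "set_integrable lborel {s..t} g" "(LINT x:{s..t}|lborel. g x) = u t - u s"
proof -
  show i: "set_integrable lborel {s..t} g"
    using assms by (intro set_integrable_Icc_of_square) (auto simp: H1_deriv_def)
  have "(g has_integral (u t - u s)) {s..t}" using assms by (simp add: H1_deriv_def)
  then show "(LINT x:{s..t}|lborel. g x) = u t - u s"
    by (simp add: set_borel_integral_eq_integral(2)[OF i] integral_unique)
qed

text \<open>Since \<open>wderiv\<close> picks a derivative by \<open>SOME\<close>, this is what
  allows \<open>Ifun\<close> to be computed from any explicit weak derivative.\<close>

lemma H1_deriv_unique:
  assumes g: "H1_deriv u g" and h: "H1_deriv u h"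
  shows "AE x in lborel. g x = h x"
proof -
  \<comment> \<open>Square integrability gives integrability on bounded intervals only, hence the
    cut-off. The countably many exceptional null sets are united afterwards.\<close>
  have "AE x in lborel. indicator {- real n..real n} x *\<^sub>R (g x - h x) = 0" for n
  proof (rule AE_zero_of_interval_integrals)
    have si: "set_integrable lborel {s..t} (\<lambda>x. g x - h x)"
      and s0: "(LINT x:{s..t}|lborel. g x - h x) = 0" if "s \<le> t" for s t
      using that H1_deriv_set_integral[OF g] H1_deriv_set_integral[OF h]
      by (auto intro: set_integral_diff)
    show "complex_integrable lborel (\<lambda>x. indicat_real {- real n..real n} x *\<^sub>R (g x - h x))"
      using si[of "- real n" "real n"] by (simp add: set_integrable_def)
    show "(LINT y|lborel. indicat_real {- real n..real n} y *\<^sub>R (g y - h y)) = 0"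
      using s0[of "- real n" "real n"] by (simp add: set_lebesgue_integral_def)
    fix s t :: real
    have "(LINT y:{s..t}|lborel. indicat_real {- real n..real n} y *\<^sub>R (g y - h y)) =
       (LINT y:{max s (- real n)..min t (real n)}|lborel. g y - h y)"
      unfolding set_lebesgue_integral_def
      by (intro Bochner_Integration.integral_cong) (auto simp: indicator_def)
    also have "\<dots> = 0"
      using s0[of "max s (- real n)" "min t (real n)"]
      by (cases "max s (- real n) \<le> min t (real n)") (auto simp: set_lebesgue_integral_def)
    finally show "(LINT y:{s..t}|lborel. indicat_real {- real n..real n} y *\<^sub>R (g y - h y)) = 0" .
  qed
  then have "AE x in lborel. \<forall>n::nat. indicat_real {- real n..real n} x *\<^sub>R (g x - h x) = 0"
    by (simp only: AE_all_countable) simp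
  then show ?thesis
  proof (rule AE_mp, intro AE_I2 impI)
    fix x assume *: "\<forall>n::nat. indicat_real {- real n..real n} x *\<^sub>R (g x - h x) = 0"
    obtain n :: nat where "\<bar>x\<bar> \<le> n" using real_arch_simple by blast
    then show "g x = h x" using *[rule_format, of n] by (auto simp: indicator_def)
  qed
qed

section \<open>Lower energy bounds from Picone's identity\<close>

text \<open>Picone's identity: with \<open>W x = l tan (l (x0 - x))\<close>, a solution of \<open>W' = - l\<^sup>2 - W\<^sup>2\<close>, one has
  \<open>|g|\<^sup>2 - l\<^sup>2 |u|\<^sup>2 = |g - W u|\<^sup>2 + (W |u|\<^sup>2)'\<close>.\<close>

lemma picone_bound:
  fixes u g :: "real \<Rightarrow> 'a::euclidean_space"
  assumes bx: "b \<le> x0" and l: "0 < l" "l * (x0 - b) < pi / 2"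
    and g: "g absolutely_integrable_on {b..x0}" and g2: "(\<lambda>x. (norm (g x))\<^sup>2) integrable_on {b..x0}"
    and U: "\<And>s t. b \<le> s \<Longrightarrow> s \<le> t \<Longrightarrow> t \<le> x0 \<Longrightarrow> (g has_integral u t - u s) {s..t}"
  shows "- ((norm (u b))\<^sup>2 * l * tan (l * (x0 - b)))
           \<le> integral {b..x0} (\<lambda>x. (norm (g x))\<^sup>2 - l\<^sup>2 * (norm (u x))\<^sup>2)"
proof -
  define W where "W = (\<lambda>x. l * tan (l * (x0 - x)))"
  define W' where "W' = (\<lambda>x. - (l\<^sup>2 + (W x)\<^sup>2))"
  \<comment> \<open>The angle stays in \<open>[0, pi / 2)\<close>, so \<open>W\<close> has no pole
    on the interval.\<close>
  have cos: "cos (l * (x0 - x)) > 0" if "x \<in> {b..x0}" for x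
  proof (rule cos_gt_zero_pi)
    have "l * (x0 - x) \<le> l * (x0 - b)" using that l by (intro mult_left_mono) auto
    then show "l * (x0 - x) < pi / 2" using l by linarith
    have "0 \<le> l * (x0 - x)" using that l by auto
    then show "- (pi / 2) < l * (x0 - x)" using pi_gt_zero by linarith
  qed
  have dW: "(W has_vector_derivative W' x) (at x within S)" if "x \<in> {b..x0}" for x S
    unfolding W_def W'_def has_real_derivative_iff_has_vector_derivative[symmetric]
    using cos[OF that] by (auto intro!: derivative_eq_intros simp: tan_def field_simps power2_eq_square sin_squared_eq)
  have contW: "continuous_on {b..x0} W'"
    using cos unfolding W_def W'_def by (intro continuous_intros) force+
  have 1: "(W' has_integral W t - W s) {s..t}" if "b \<le> s" "s \<le> t" "t \<le> x0" for s t
    using that by (intro fundamental_theorem_of_calculus dW) auto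
  have W'ai: "W' absolutely_integrable_on {b..x0}"
    using contW by (rule absolutely_integrable_continuous_real)
  have sub: "g absolutely_integrable_on {s..t}" "W' absolutely_integrable_on {s..t}" if "b \<le> s" "t \<le> x0" for s t
    using that by (auto intro: set_integrable_subset[OF g] set_integrable_subset[OF W'ai])
  note H = bilinear_indefinite_integral[OF bounded_bilinear_scaleR, of _ _ W' g W u]
  \<comment> \<open>The product rule is used twice: for \<open>W\<close> times \<open>u\<close>, and
    then for the inner product of that with \<open>u\<close>. As \<open>W x0 = 0\<close>, only the
    boundary term at \<open>b\<close> survives.\<close>
  have 2: "((\<lambda>x. u x \<bullet> (W x *\<^sub>R g x + W' x *\<^sub>R u x) + g x \<bullet> (W x *\<^sub>R u x)) has_integral
           (u x0 \<bullet> (W x0 *\<^sub>R u x0) - u b \<bullet> (W b *\<^sub>R u b))) {b..x0}"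
    by (rule bilinear_indefinite_integral[OF bounded_bilinear_inner])
      (use bx in \<open>auto intro!: H 1 U sub\<close>)
  have contu: "continuous_on {b..x0} u"
    using bx U[of b] by (intro continuous_on_primitive) auto
  have "(\<lambda>x. (norm (g x))\<^sup>2 - l\<^sup>2 * (norm (u x))\<^sup>2) integrable_on {b..x0}"
    by (intro integrable_diff g2 integrable_continuous_real continuous_intros contu)
  moreover have "u x \<bullet> (W x *\<^sub>R g x + W' x *\<^sub>R u x) + g x \<bullet> (W x *\<^sub>R u x) \<le> (norm (g x))\<^sup>2 - l\<^sup>2 * (norm (u x))\<^sup>2" for x
  proof -
    have "0 \<le> (norm (g x - W x *\<^sub>R u x))\<^sup>2" by simp
    also have "\<dots> = (norm (g x))\<^sup>2 - l\<^sup>2 * (norm (u x))\<^sup>2 - (u x \<bullet> (W x *\<^sub>R g x + W' x *\<^sub>R u x) + g x \<bullet> (W x *\<^sub>R u x))"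
      unfolding power2_norm_eq_inner by (simp add: algebra_simps W'_def power2_eq_square inner_commute)
    finally show ?thesis by simp
  qed
  ultimately show ?thesis
    using 2 has_integral_le[OF 2, of "\<lambda>x. (norm (g x))\<^sup>2 - l\<^sup>2 * (norm (u x))\<^sup>2"]
    by (simp add: has_integral_iff W_def power2_norm_eq_inner mult.assoc mult.left_commute) (simp add: mult_ac)
qed

text \<open>For \<open>l = k\<close> the boundary term in Picone's bound is \<open>(cos
  \<theta>)\<^sup>2 * k * tan \<theta> = k * cos \<theta> * sin \<theta>\<close>. Up to sign this is
  the energy of the cosine arc itself, so the bound is sharp.\<close>

lemma quarter_wave_bound:
  fixes u g :: "real \<Rightarrow> 'a::euclidean_space"
  assumes k: "0 < k" and x0: "x0 = b + \<theta> / k" and \<theta>: "0 \<le> \<theta>" "\<theta> \<le> pi / 2" and ub: "norm (u b) = cos \<theta>"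
    and g: "g absolutely_integrable_on {b..x0}" and g2: "(\<lambda>x. (norm (g x))\<^sup>2) integrable_on {b..x0}"
    and U: "\<And>s t. b \<le> s \<Longrightarrow> s \<le> t \<Longrightarrow> t \<le> x0 \<Longrightarrow> (g has_integral u t - u s) {s..t}"
  shows "- (k * cos \<theta> * sin \<theta>) \<le> integral {b..x0} (\<lambda>x. (norm (g x))\<^sup>2 - k\<^sup>2 * (norm (u x))\<^sup>2)"
proof -
  have bx: "b \<le> x0" using k \<theta> x0 by simp
  have kx: "k * (x0 - b) = \<theta>" using k x0 by simp
  show ?thesis
  proof (cases "\<theta> = pi / 2")
    case False
    then have "cos \<theta> > 0" using \<theta> by (intro cos_gt_zero_pi) (use pi_gt_zero in linarith)+
    then show ?thesis
      using picone_bound[OF bx k _ g g2 U] False \<theta> kx ub by (simp add: tan_def power2_eq_square mult_ac)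
  next
    case True
    \<comment> \<open>Here \<open>W\<close> with \<open>l = k\<close> blows up at \<open>b\<close>, so the bound is obtained for \<open>l < k\<close> and \<open>l\<close> tends to \<open>k\<close>.\<close>
    have u2: "(\<lambda>x. (norm (u x))\<^sup>2) integrable_on {b..x0}"
      using bx U[of b] by (intro integrable_continuous_real continuous_intros continuous_on_primitive) auto
    have split: "integral {b..x0} (\<lambda>x. (norm (g x))\<^sup>2 - c * (norm (u x))\<^sup>2) =
        integral {b..x0} (\<lambda>x. (norm (g x))\<^sup>2) - c * integral {b..x0} (\<lambda>x. (norm (u x))\<^sup>2)" for c
      by (subst Henstock_Kurzweil_Integration.integral_diff) (auto intro!: g2 u2 integrable_on_mult_right)
    have "k\<^sup>2 * integral {b..x0} (\<lambda>x. (norm (u x))\<^sup>2) \<le> integral {b..x0} (\<lambda>x. (norm (g x))\<^sup>2)"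
    proof (rule field_le_mult_one_interval)
      fix z :: real assume z: "0 < z" "z < 1"
      have "k * sqrt z * (x0 - b) = sqrt z * (pi / 2)"
        using kx True by (metis mult.assoc mult.commute)
      also have "\<dots> < 1 * (pi / 2)"
        using z by (intro mult_strict_right_mono) auto
      finally have "k * sqrt z * (x0 - b) < pi / 2" by simp
      \<comment> \<open>Here \<open>norm (u b) = cos (pi / 2) = 0\<close>, so the boundary term
        vanishes for every \<open>l = k * sqrt z\<close>, whatever the size of its tangent.\<close>
      then have "0 \<le> integral {b..x0} (\<lambda>x. (norm (g x))\<^sup>2 - (k * sqrt z)\<^sup>2 * (norm (u x))\<^sup>2)"
        using picone_bound[OF bx _ _ g g2 U, of "k * sqrt z"] k z ub True by simp
      then show "z * (k\<^sup>2 * integral {b..x0} (\<lambda>x. (norm (u x))\<^sup>2)) \<le> integral {b..x0} (\<lambda>x. (norm (g x))\<^sup>2)"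
        using z unfolding split by (simp add: power_mult_distrib mult_ac)
    qed
    then show ?thesis by (simp add: split True)
  qed
qed

section \<open>The extremal profile and its minimality\<close>

text \<open>The \<open>max\<close> puts the cosine arc before \<open>x0\<close> and the constant 1
  after it into one formula. The slope is zero at \<open>x0\<close>, so the derivative is continuous
  there as well.\<close>

definition quarter_wave :: "real \<Rightarrow> real \<Rightarrow> real \<Rightarrow> real" where
  "quarter_wave k x0 x = cos (k * max 0 (x0 - x))"

definition quarter_wave' :: "real \<Rightarrow> real \<Rightarrow> real \<Rightarrow> real" where
  "quarter_wave' k x0 x = k * sin (k * max 0 (x0 - x))"

lemma has_integral_quarter_wave:
  assumes "s \<le> t"
  shows "(quarter_wave' k x0 has_integral quarter_wave k x0 t - quarter_wave k x0 s) {s..t}"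
proof (rule fundamental_theorem_of_calculus_interior_strong[of "{x0}"])
  fix x assume "x \<in> {s<..<t} - {x0}"
  then consider "x < x0" | "x0 < x" by force
  then show "(quarter_wave k x0 has_vector_derivative quarter_wave' k x0 x) (at x)"
  proof cases
    case 1
    have "((\<lambda>x. cos (k * (x0 - x))) has_vector_derivative quarter_wave' k x0 x) (at x)"
      using 1 unfolding has_real_derivative_iff_has_vector_derivative[symmetric]
      by (auto intro!: derivative_eq_intros simp: quarter_wave'_def)
    then show ?thesis
      by (rule has_vector_derivative_transform_within_open[of _ _ _ "{..<x0}"])
        (use 1 in \<open>auto simp: quarter_wave_def\<close>)
  next
    case 2
    have "((\<lambda>x. 1) has_vector_derivative quarter_wave' k x0 x) (at x)"
      using 2 by (simp add: quarter_wave'_def)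
    then show ?thesis
      by (rule has_vector_derivative_transform_within_open[of _ _ _ "{x0<..}"])
        (use 2 in \<open>auto simp: quarter_wave_def\<close>)
  qed
qed (use assms in \<open>auto simp: quarter_wave_def intro!: continuous_intros\<close>)

lemma quarter_wave_energy:
  assumes "b \<le> x0" "x0 \<le> a"
  shows "((\<lambda>x. (quarter_wave' k x0 x)\<^sup>2 - k\<^sup>2 * (quarter_wave k x0 x)\<^sup>2) has_integral
     - (k * cos (k * (x0 - b)) * sin (k * (x0 - b))) + - (k\<^sup>2 * (a - x0))) {b..a}"
proof (rule has_integral_combine[OF assms])
  \<comment> \<open>On the arc, \<open>\<Phi>\<close> is the profile \<open>q\<close> times its
    derivative. Since \<open>q'' = - k\<^sup>2 q\<close>, its derivative is
    \<open>q'\<^sup>2 - k\<^sup>2 q\<^sup>2\<close>, and it vanishes at \<open>x0\<close>.\<close>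
  define \<Phi> where "\<Phi> = (\<lambda>x. k * cos (k * (x0 - x)) * sin (k * (x0 - x)))"
  have "((\<lambda>x. (quarter_wave' k x0 x)\<^sup>2 - k\<^sup>2 * (quarter_wave k x0 x)\<^sup>2) has_integral \<Phi> x0 - \<Phi> b) {b..x0}"
  proof (rule fundamental_theorem_of_calculus[OF assms(1)])
    fix x assume "x \<in> {b..x0}"
    then show "(\<Phi> has_vector_derivative (quarter_wave' k x0 x)\<^sup>2 - k\<^sup>2 * (quarter_wave k x0 x)\<^sup>2) (at x within {b..x0})"
      unfolding has_real_derivative_iff_has_vector_derivative[symmetric] \<Phi>_def
      by (auto intro!: derivative_eq_intros simp: quarter_wave'_def quarter_wave_def power2_eq_square algebra_simps)
  qed
  then show "((\<lambda>x. (quarter_wave' k x0 x)\<^sup>2 - k\<^sup>2 * (quarter_wave k x0 x)\<^sup>2) has_integral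
     - (k * cos (k * (x0 - b)) * sin (k * (x0 - b)))) {b..x0}"
    by (simp add: \<Phi>_def)
  have "((\<lambda>x. - (k\<^sup>2)) has_integral - (k\<^sup>2 * (a - x0))) {x0..a}"
    using has_integral_const_real[of "- (k\<^sup>2)" x0 a] assms by (simp add: mult_ac)
  then show "((\<lambda>x. (quarter_wave' k x0 x)\<^sup>2 - k\<^sup>2 * (quarter_wave k x0 x)\<^sup>2) has_integral - (k\<^sup>2 * (a - x0))) {x0..a}"
    by (rule has_integral_eq[rotated]) (auto simp: quarter_wave'_def quarter_wave_def)
qed

text \<open>The energy is bounded below separately on the two sides of \<open>x0\<close>: by
  Picone's bound on \<open>{b..x0}\<close>, and on \<open>{x0..a}\<close> by dropping
  \<open>g\<close> and using \<open>norm (u x) \<le> 1\<close>. The profile attains equality in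
  both.\<close>

lemma quarter_wave_minimal:
  fixes u g :: "real \<Rightarrow> 'a::euclidean_space"
  assumes k: "0 < k" and ba: "b + pi / (2 * k) \<le> a"
    and u1: "\<And>x. x \<in> {b..a} \<Longrightarrow> norm (u x) \<le> 1"
    and g: "g absolutely_integrable_on {b..a}" and g2: "(\<lambda>x. (norm (g x))\<^sup>2) integrable_on {b..a}"
    and U: "\<And>s t. b \<le> s \<Longrightarrow> s \<le> t \<Longrightarrow> t \<le> a \<Longrightarrow> (g has_integral u t - u s) {s..t}"
  defines "x0 \<equiv> b + arccos (norm (u b)) / k"
  shows "b \<le> x0" "x0 \<le> a" "quarter_wave k x0 b = norm (u b)"
    and "integral {b..a} (\<lambda>x. (quarter_wave' k x0 x)\<^sup>2 - k\<^sup>2 * (quarter_wave k x0 x)\<^sup>2)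
           \<le> integral {b..a} (\<lambda>x. (norm (g x))\<^sup>2 - k\<^sup>2 * (norm (u x))\<^sup>2)"
proof -
  define \<theta> where "\<theta> = arccos (norm (u b))"
  have "b \<le> a" using k ba pi_gt_zero by (smt (verit) divide_nonneg_pos)
  then have ub: "norm (u b) \<le> 1" "- 1 \<le> norm (u b)" using u1[of b] norm_ge_zero[of "u b"] by (auto simp del: norm_ge_zero)
  have \<theta>: "0 \<le> \<theta>" "\<theta> \<le> pi / 2" "cos \<theta> = norm (u b)"
    unfolding \<theta>_def using ub by (blast intro: arccos_lbound arccos_le_pi2 cos_arccos norm_ge_zero)+
  show bx: "b \<le> x0" using k \<theta> by (simp add: x0_def \<theta>_def)
  \<comment> \<open>The arc takes at most a quarter of a wavelength because a norm is non-negative;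
    \<open>ba\<close> ensures that it fits before \<open>a\<close>.\<close>
  have "\<theta> / k \<le> pi / (2 * k)" using k \<theta> by (simp add: field_simps)
  then show xa: "x0 \<le> a" using ba by (simp add: x0_def \<theta>_def)
  have kx: "k * (x0 - b) = \<theta>" using k by (simp add: x0_def \<theta>_def)
  then show "quarter_wave k x0 b = norm (u b)"
    using bx \<theta> by (simp add: quarter_wave_def)
  have contu: "continuous_on {b..a} u"
    using \<open>b \<le> a\<close> U[of b] by (intro continuous_on_primitive) auto
  have i: "(\<lambda>x. (norm (g x))\<^sup>2 - k\<^sup>2 * (norm (u x))\<^sup>2) integrable_on {b..a}"
    by (intro integrable_diff g2 integrable_continuous_real continuous_intros contu)
  have "- (k * cos \<theta> * sin \<theta>) \<le> integral {b..x0} (\<lambda>x. (norm (g x))\<^sup>2 - k\<^sup>2 * (norm (u x))\<^sup>2)"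
  proof (rule quarter_wave_bound[where b = b and u = u, OF k _ \<theta>(1,2) \<theta>(3)[symmetric]])
    show "x0 = b + \<theta> / k" by (simp add: x0_def \<theta>_def)
    show "g absolutely_integrable_on {b..x0}" by (rule set_integrable_subset[OF g]) (use xa in auto)
    show "(\<lambda>x. (norm (g x))\<^sup>2) integrable_on {b..x0}" by (rule integrable_subinterval_real[OF g2]) (use xa in auto)
    show "(g has_integral u t - u s) {s..t}" if "b \<le> s" "s \<le> t" "t \<le> x0" for s t
      using that xa by (intro U) auto
  qed
  moreover have "- (k\<^sup>2 * (a - x0)) \<le> integral {x0..a} (\<lambda>x. (norm (g x))\<^sup>2 - k\<^sup>2 * (norm (u x))\<^sup>2)"
  proof -
    have "integral {x0..a} (\<lambda>x. - (k\<^sup>2)) \<le> integral {x0..a} (\<lambda>x. (norm (g x))\<^sup>2 - k\<^sup>2 * (norm (u x))\<^sup>2)"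
    proof (rule integral_le)
      fix x assume "x \<in> {x0..a}"
      then have "(norm (u x))\<^sup>2 \<le> 1" using bx u1[of x] by (simp add: power_le_one)
      then have "k\<^sup>2 * (norm (u x))\<^sup>2 \<le> k\<^sup>2" by (simp add: mult_left_le)
      then show "- (k\<^sup>2) \<le> (norm (g x))\<^sup>2 - k\<^sup>2 * (norm (u x))\<^sup>2"
        using zero_le_power2[of "norm (g x)"] by linarith
    qed (use integrable_subinterval_real[OF i] bx in auto)
    then show ?thesis using xa by (simp add: mult_ac)
  qed
  ultimately show "integral {b..a} (\<lambda>x. (quarter_wave' k x0 x)\<^sup>2 - k\<^sup>2 * (quarter_wave k x0 x)\<^sup>2)
           \<le> integral {b..a} (\<lambda>x. (norm (g x))\<^sup>2 - k\<^sup>2 * (norm (u x))\<^sup>2)"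
    unfolding integral_unique[OF quarter_wave_energy[OF bx xa, of k]] kx
      Henstock_Kurzweil_Integration.integral_combine[OF bx xa i, symmetric]
    by (rule add_mono)
qed

section \<open>Gluing, bounded multipliers and reflection\<close>

lemma has_integral_glue:
  fixes f1 f2 :: "real \<Rightarrow> 'a::banach"
  assumes 1: "\<And>s t. s \<le> t \<Longrightarrow> t \<le> p \<Longrightarrow> (f1 has_integral F1 t - F1 s) {s..t}"
    and 2: "\<And>s t. p \<le> s \<Longrightarrow> s \<le> t \<Longrightarrow> (f2 has_integral F2 t - F2 s) {s..t}"
    and p: "F1 p = F2 p" and st: "s \<le> t"
  defines "f \<equiv> \<lambda>x. if x \<le> p then f1 x else f2 x" and "F \<equiv> \<lambda>x. if x \<le> p then F1 x else F2 x"
  shows "(f has_integral F t - F s) {s..t}"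
proof -
  have l: "(f has_integral F1 t - F1 s) {s..t}" if "s \<le> t" "t \<le> p" for s t
    using 1[OF that] by (rule has_integral_eq[rotated]) (use that in \<open>auto simp: f_def\<close>)
  \<comment> \<open>At \<open>p\<close> itself \<open>f\<close> takes the value of
    \<open>f1\<close>, so the right-hand piece agrees with \<open>f2\<close> only off that
    point.\<close>
  have r: "(f has_integral F2 t - F2 s) {s..t}" if "p \<le> s" "s \<le> t" for s t
    using _ _ 2[OF that] by (rule has_integral_spike_finite[of "{p}"]) (use that in \<open>auto simp: f_def\<close>)
  consider "t \<le> p" | "p < s" | "s \<le> p" "p < t" by linarith
  then show ?thesis
  proof cases
    case 3
    then have "(f has_integral (F1 p - F1 s) + (F2 t - F2 p)) {s..t}"
      by (intro has_integral_combine[of s p t] l r) auto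
    then show ?thesis using 3 p by (simp add: F_def)
  qed (use l r st in \<open>auto simp: F_def\<close>)
qed

lemma set_integrable_lebesgueI:
  fixes f :: "'a::euclidean_space \<Rightarrow> 'b::{banach, second_countable_topology}"
  assumes "set_integrable lborel S f"
  shows "set_integrable lebesgue S f"
  using assms unfolding set_integrable_def
  by (subst integrable_completion) auto

lemma set_integrable_Linfty_mult:
  fixes f :: "real \<Rightarrow> real"
  assumes "V \<in> Linfty" and f: "set_integrable lborel A f"
  shows "set_integrable lborel A (\<lambda>x. V x * f x)"
proof -
  obtain M where V[measurable]: "V \<in> borel_measurable lborel" and M: "AE x in lborel. \<bar>V x\<bar> \<le> M"
    using assms by (auto simp: Linfty_def)
  have [measurable]: "(\<lambda>x. indicator A x *\<^sub>R f x) \<in> borel_measurable lborel"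
    using f unfolding set_integrable_def by auto
  have "integrable lborel (\<lambda>x. V x * (indicator A x *\<^sub>R f x))"
  proof (rule Bochner_Integration.integrable_bound)
    show "integrable lborel (\<lambda>x. M * (indicator A x *\<^sub>R f x))"
      using f unfolding set_integrable_def by (rule integrable_mult_right)
    show "AE x in lborel. norm (V x * (indicator A x *\<^sub>R f x)) \<le> norm (M * (indicator A x *\<^sub>R f x))"
      using M by eventually_elim (auto simp: abs_mult intro!: mult_right_mono)
  qed measurable
  then show ?thesis by (simp add: set_integrable_def mult_ac)
qed

lemma AE_lborel_uminus:
  fixes P :: "real \<Rightarrow> bool"
  assumes "AE x in lborel. P x"
  shows "AE x in lborel. P (- x)"
proof (rule AE_distrD[of uminus lborel borel])
  show "AE x in distr lborel borel uminus. P x"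
    unfolding lborel_distr_uminus by (rule assms)
qed simp

lemma Linfty_uminus: "V \<in> Linfty \<Longrightarrow> (\<lambda>x. V (- x)) \<in> Linfty"
  using AE_lborel_uminus[of "\<lambda>x. \<bar>V x\<bar> \<le> _"] by (fastforce simp: Linfty_def)

lemma integrable_lborel_uminus_iff:
  fixes f :: "real \<Rightarrow> 'a::{banach, second_countable_topology}"
  shows "integrable lborel (\<lambda>x. f (- x)) \<longleftrightarrow> integrable lborel f"
  using lborel_integrable_real_affine_iff[of "-1" f 0] by simp

lemma has_integral_uminus_primitive:
  fixes h :: "real \<Rightarrow> 'a::real_normed_vector"
  assumes "(h has_integral v (- s) - v (- t)) {- t..- s}"
  shows "((\<lambda>x. - h (- x)) has_integral v (- t) - v (- s)) {s..t}"
proof -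
  have "((\<lambda>x. h (- x)) has_integral v (- s) - v (- t)) {s..t}"
    using assms has_integral_reflect_real[of h _ "- s" "- t"] by simp
  from has_integral_neg[OF this] show ?thesis by simp
qed

lemma H1_deriv_uminus:
  assumes "H1_deriv u g"
  shows "H1_deriv (\<lambda>x. u (- x)) (\<lambda>x. - g (- x))"
  using assms integrable_lborel_uminus_iff[of "\<lambda>x. (cmod (u x))\<^sup>2"] integrable_lborel_uminus_iff[of "\<lambda>x. (cmod (g x))\<^sup>2"]
  unfolding H1_deriv_def by (auto intro!: has_integral_uminus_primitive)

section \<open>Construction of competitors with value 1 at \<open>a\<close>\<close>

text \<open>Left of \<open>b\<close> the function changes only by a constant phase, which leaves all
  moduli alone, so no sign of \<open>V\<close> is needed there. Beyond \<open>a\<close> the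
  constructed function stays equal to 1, which is why square integrability is claimed on
  \<open>{..a}\<close> only.\<close>

lemma half_line_competitor:
  assumes k: "0 < k" and ba: "b + pi / (2 * k) \<le> a" and V: "V \<in> Linfty" "\<And>x. x \<in> {b<..<a} \<Longrightarrow> V x = - k\<^sup>2"
    and u: "H1_deriv u g" and u1: "\<And>x. cmod (u x) \<le> 1"
  obtains v h where "v \<in> borel_measurable lborel" "h \<in> borel_measurable lborel"
    "v a = 1" "\<And>x. cmod (v x) \<le> 1" "\<And>s t. s \<le> t \<Longrightarrow> (h has_integral v t - v s) {s..t}"
    "set_integrable lborel {..a} (\<lambda>x. (cmod (v x))\<^sup>2)" "set_integrable lborel {..a} (\<lambda>x. (cmod (h x))\<^sup>2)"
    "(LINT x:{..a}|lborel. (cmod (h x))\<^sup>2 + V x * (cmod (v x))\<^sup>2)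
       \<le> (LINT x:{..a}|lborel. (cmod (g x))\<^sup>2 + V x * (cmod (u x))\<^sup>2)"
proof -
  have u_meas[measurable]: "u \<in> borel_measurable lborel" and g_meas[measurable]: "g \<in> borel_measurable lborel"
    and u2: "integrable lborel (\<lambda>x. (cmod (u x))\<^sup>2)" and g2: "integrable lborel (\<lambda>x. (cmod (g x))\<^sup>2)"
    and U: "\<And>s t. s \<le> t \<Longrightarrow> (g has_integral u t - u s) {s..t}"
    using u by (auto simp: H1_deriv_def)
  define x0 where "x0 = b + arccos (cmod (u b)) / k"
  have si: "set_integrable lborel A f" if "integrable lborel f" "A \<in> sets borel" for f :: "real \<Rightarrow> real" and A
    using that unfolding set_integrable_def by (intro integrable_mult_indicator) auto
  have gi: "g absolutely_integrable_on {b..a}"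
    by (intro set_integrable_lebesgueI set_integrable_Icc_of_square g2) simp
  have g2i: "(\<lambda>x. (cmod (g x))\<^sup>2) integrable_on {b..a}"
    by (intro set_borel_integral_eq_integral(1) si g2) simp
  note qw = quarter_wave_minimal[OF k ba _ gi g2i, of u, OF u1 U, folded x0_def]
  \<comment> \<open>This unit factor rotates \<open>u b\<close> to its modulus, the value of the
    real profile at \<open>b\<close>.\<close>
  define \<sigma> where "\<sigma> = cis (- Arg (u b))"
  have \<sigma>: "cmod \<sigma> = 1" "\<sigma> * u b = of_real (cmod (u b))"
  proof -
    show "cmod \<sigma> = 1" by (simp add: \<sigma>_def)
    have "\<sigma> * u b = of_real (cmod (u b)) * (cis (- Arg (u b)) * cis (Arg (u b)))"
      by (subst rcis_cmod_Arg[of "u b", symmetric]) (simp add: rcis_def \<sigma>_def)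
    then show "\<sigma> * u b = of_real (cmod (u b))" by (simp add: cis_mult)
  qed
  define v where "v = (\<lambda>x. if x \<le> b then \<sigma> * u x else of_real (quarter_wave k x0 x))"
  define h where "h = (\<lambda>x. if x \<le> b then \<sigma> * g x else of_real (quarter_wave' k x0 x))"
  have bx: "b \<le> x0" "x0 \<le> a" and qb: "quarter_wave k x0 b = cmod (u b)" using qw by auto
  have cont: "continuous_on A (quarter_wave k x0)" "continuous_on A (quarter_wave' k x0)" for A
    unfolding quarter_wave_def quarter_wave'_def by (intro continuous_intros)+
  then have [measurable]: "quarter_wave k x0 \<in> borel_measurable borel" "quarter_wave' k x0 \<in> borel_measurable borel"
    by (auto intro: borel_measurable_continuous_onI)
  have meas: "v \<in> borel_measurable lborel" "h \<in> borel_measurable lborel"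
    unfolding v_def h_def by measurable
  have va: "v a = 1"
    using bx qb \<sigma> by (cases "a = b") (auto simp: v_def quarter_wave_def)
  have v1: "cmod (v x) \<le> 1" for x
    using u1[of x] \<sigma>(1) by (auto simp: v_def norm_mult quarter_wave_def)
  have vh: "(h has_integral v t - v s) {s..t}" if "s \<le> t" for s t
    unfolding v_def h_def
  proof (rule has_integral_glue[OF _ _ _ that])
    fix s t :: real assume "s \<le> t"
    show "((\<lambda>x. \<sigma> * g x) has_integral \<sigma> * u t - \<sigma> * u s) {s..t}"
      using has_integral_mult_right[OF U[OF \<open>s \<le> t\<close>], of \<sigma>] by (simp add: algebra_simps)
    show "((\<lambda>x. complex_of_real (quarter_wave' k x0 x)) has_integral
        of_real (quarter_wave k x0 t) - of_real (quarter_wave k x0 s)) {s..t}"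
      using has_integral_linear[OF has_integral_quarter_wave[OF \<open>s \<le> t\<close>] bounded_linear_of_real] by (simp add: o_def)
  qed (simp add: \<sigma> qb)
  define e where "e = (\<lambda>x. (cmod (h x))\<^sup>2 + V x * (cmod (v x))\<^sup>2)"
  define e' where "e' = (\<lambda>x. (cmod (g x))\<^sup>2 + V x * (cmod (u x))\<^sup>2)"
  have eL: "e x = e' x" "cmod (v x) = cmod (u x)" "cmod (h x) = cmod (g x)" if "x \<le> b" for x
    using that \<sigma>(1) by (auto simp: e_def e'_def v_def h_def norm_mult)
  \<comment> \<open>The equalities may fail at the endpoints: \<open>V\<close> is prescribed on the
    open interval only, and at \<open>b\<close> the functions \<open>v\<close> and \<open>h\<close>
    still follow \<open>u\<close> and \<open>g\<close>.\<close>
  have eR: "AE x in lborel. x \<in> {b..a} \<longrightarrow> e x = (quarter_wave' k x0 x)\<^sup>2 - k\<^sup>2 * (quarter_wave k x0 x)\<^sup>2"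
    "AE x in lborel. x \<in> {b..a} \<longrightarrow> e' x = (cmod (g x))\<^sup>2 - k\<^sup>2 * (cmod (u x))\<^sup>2"
    using AE_lborel_singleton[of a] AE_lborel_singleton[of b]
    by (eventually_elim; auto simp: e_def e'_def v_def h_def V)+
  have Un: "{..a} = {..b} \<union> {b..a}" using bx by auto
  have vR: "AE x in lborel. x \<in> {b..a} \<longrightarrow> (cmod (v x))\<^sup>2 = (quarter_wave k x0 x)\<^sup>2"
    "AE x in lborel. x \<in> {b..a} \<longrightarrow> (cmod (h x))\<^sup>2 = (quarter_wave' k x0 x)\<^sup>2"
    using AE_lborel_singleton[of b]
    by (eventually_elim; auto simp: v_def h_def)+
  have [measurable]: "V \<in> borel_measurable lborel" using V by (simp add: Linfty_def)
  note meas[measurable]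
  have v2R: "set_integrable lborel {b..a} (\<lambda>x. (cmod (v x))\<^sup>2)"
    by (rule set_integrable_cong_AE[THEN iffD2, OF _ _ vR(1)])
      (auto intro!: borel_integrable_atLeastAtMost' continuous_intros cont)
  have h2R: "set_integrable lborel {b..a} (\<lambda>x. (cmod (h x))\<^sup>2)"
    by (rule set_integrable_cong_AE[THEN iffD2, OF _ _ vR(2)])
      (auto intro!: borel_integrable_atLeastAtMost' continuous_intros cont)
  have v2L: "set_integrable lborel {..b} (\<lambda>x. (cmod (v x))\<^sup>2)"
    using si[OF u2, of "{..b}"] by (rule set_integrable_cong[THEN iffD1, rotated -1]) (auto simp: eL)
  have h2L: "set_integrable lborel {..b} (\<lambda>x. (cmod (h x))\<^sup>2)"
    using si[OF g2, of "{..b}"] by (rule set_integrable_cong[THEN iffD1, rotated -1]) (auto simp: eL)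
  have v2: "set_integrable lborel {..a} (\<lambda>x. (cmod (v x))\<^sup>2)" unfolding Un
    by (rule set_integrable_Un[OF v2L v2R]) auto
  have h2: "set_integrable lborel {..a} (\<lambda>x. (cmod (h x))\<^sup>2)" unfolding Un
    by (rule set_integrable_Un[OF h2L h2R]) auto
  have ei: "set_integrable lborel {..a} e"
    unfolding e_def by (intro set_integral_add(1) h2 set_integrable_Linfty_mult v2 V)
  have e'i: "set_integrable lborel A e'" if "A \<in> sets borel" for A
    unfolding e'_def by (intro set_integral_add(1) si g2 u2 that set_integrable_Linfty_mult V)
  have disj: "AE x in lborel. \<not> (x \<in> {..b} \<and> x \<in> {b..a})"
    using AE_lborel_singleton[of b] by eventually_elim auto
  \<comment> \<open>The contributions of \<open>{..b}\<close> coincide; the inequality comes from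
    \<open>{b..a}\<close> alone, by minimality of the profile.\<close>
  have "(LINT x:{..a}|lborel. e x) = (LINT x:{..b}|lborel. e x) + (LINT x:{b..a}|lborel. e x)"
    unfolding Un by (rule set_integral_Un_AE[OF disj]) (auto intro!: set_integrable_subset[OF ei] intro: order_trans[OF _ order_trans[OF bx]])
  also have "(LINT x:{..b}|lborel. e x) = (LINT x:{..b}|lborel. e' x)"
    by (rule set_lebesgue_integral_cong) (auto simp: eL)
  also have "(LINT x:{b..a}|lborel. e x) = (LINT x:{b..a}|lborel. (quarter_wave' k x0 x)\<^sup>2 - k\<^sup>2 * (quarter_wave k x0 x)\<^sup>2)"
    by (rule set_lebesgue_integral_cong_AE[OF _ _ _ eR(1)]) (auto simp: e_def)
  also have "\<dots> = integral {b..a} (\<lambda>x. (quarter_wave' k x0 x)\<^sup>2 - k\<^sup>2 * (quarter_wave k x0 x)\<^sup>2)"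
    by (intro set_borel_integral_eq_integral(2) borel_integrable_atLeastAtMost' continuous_intros cont)
  also have "\<dots> \<le> integral {b..a} (\<lambda>x. (cmod (g x))\<^sup>2 - k\<^sup>2 * (cmod (u x))\<^sup>2)"
    using qw by blast
  also have "\<dots> = (LINT x:{b..a}|lborel. (cmod (g x))\<^sup>2 - k\<^sup>2 * (cmod (u x))\<^sup>2)"
    by (intro set_borel_integral_eq_integral(2)[symmetric] set_integral_diff(1) set_integrable_mult_right si g2 u2) auto
  also have "\<dots> = (LINT x:{b..a}|lborel. e' x)"
    by (rule set_lebesgue_integral_cong_AE[symmetric, OF _ _ _ eR(2)]) (auto simp: e'_def)
  also have "(LINT x:{..b}|lborel. e' x) + (LINT x:{b..a}|lborel. e' x) = (LINT x:{..a}|lborel. e' x)"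
    unfolding Un by (rule set_integral_Un_AE[OF disj, symmetric]) (auto intro: e'i)
  finally show thesis
    by (intro that[OF meas va v1 vh v2 h2]) (auto simp: e_def e'_def)
qed

lemma integral_split_at:
  fixes f :: "real \<Rightarrow> 'a::{banach, second_countable_topology}"
  assumes "integrable lborel f"
  shows "(LINT x|lborel. f x) = (LINT x:{..a}|lborel. f x) + (LINT x:{a..}|lborel. f x)"
proof -
  have Un: "UNIV = {..a} \<union> {a..}" by auto
  have si: "set_integrable lborel A f" if "A \<in> sets borel" for A
    using that assms unfolding set_integrable_def by (intro integrable_mult_indicator) auto
  have "(LINT x|lborel. f x) = (LINT x:UNIV|lborel. f x)"
    by (simp add: set_lebesgue_integral_def)
  also have "\<dots> = (LINT x:{..a}|lborel. f x) + (LINT x:{a..}|lborel. f x)"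
    unfolding Un
    by (rule set_integral_Un_AE)
      (use AE_lborel_singleton[of a] in \<open>auto intro!: si elim!: eventually_mono\<close>)
  finally show ?thesis .
qed

lemma Ifun_eq:
  assumes "H1_deriv u g"
  shows "Ifun u V = (LINT x|lborel. (cmod (g x))\<^sup>2) + (LINT x|lborel. V x * (cmod (u x))\<^sup>2)"
proof -
  have w: "H1_deriv u (wderiv u)"
    unfolding wderiv_def by (rule someI[of "H1_deriv u", OF assms])
  have "(LINT x|lborel. (cmod (wderiv u x))\<^sup>2) = (LINT x|lborel. (cmod (g x))\<^sup>2)"
  proof (rule integral_cong_AE)
    show "AE x in lborel. (cmod (wderiv u x))\<^sup>2 = (cmod (g x))\<^sup>2"
      using H1_deriv_unique[OF w assms] by eventually_elim simp
  qed (use w assms in \<open>auto simp: H1_deriv_def\<close>)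
  then show ?thesis by (simp add: Ifun_def)
qed

lemma set_integrable_UNIV_iff: "set_integrable M UNIV f \<longleftrightarrow> integrable M f"
  by (simp add: set_integrable_def)

text \<open>A left competitor is joined to the mirror image of one built for the reflected data.
  Both equal 1 at \<open>a\<close>, so the join creates no jump and the supremum 1 is attained
  there.\<close>

lemma competitor_in_Kset:
  assumes k: "0 < k" and ba: "b + pi / (2 * k) \<le> a" and ac: "a + pi / (2 * k) \<le> c"
    and V: "V \<in> Linfty" "\<And>x. x \<in> {b<..<c} \<Longrightarrow> V x = - k\<^sup>2"
    and u: "H1_deriv u g" and u1: "\<And>x. cmod (u x) \<le> 1"
  obtains v where "v \<in> Kset a"
    "Ifun v V \<le> (LINT x|lborel. (cmod (g x))\<^sup>2) + (LINT x|lborel. V x * (cmod (u x))\<^sup>2)"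
proof -
  have "pi / (2 * k) > 0" using k by simp
  with ba ac have abc: "b < a" "a < c" by linarith+
  obtain v1 h1 where 1: "v1 \<in> borel_measurable lborel" "h1 \<in> borel_measurable lborel"
    "v1 a = 1" "\<And>x. cmod (v1 x) \<le> 1" "\<And>s t. s \<le> t \<Longrightarrow> (h1 has_integral v1 t - v1 s) {s..t}"
    "set_integrable lborel {..a} (\<lambda>x. (cmod (v1 x))\<^sup>2)" "set_integrable lborel {..a} (\<lambda>x. (cmod (h1 x))\<^sup>2)"
    "(LINT x:{..a}|lborel. (cmod (h1 x))\<^sup>2 + V x * (cmod (v1 x))\<^sup>2)
       \<le> (LINT x:{..a}|lborel. (cmod (g x))\<^sup>2 + V x * (cmod (u x))\<^sup>2)"
    by (rule half_line_competitor[OF k ba V(1) _ u u1]) (use V(2) abc in auto)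
  \<comment> \<open>Reflection turns \<open>{a..c}\<close> into \<open>{- c..- a}\<close>, with
    \<open>- c\<close> in the role of \<open>b\<close>.\<close>
  have "- c + pi / (2 * k) \<le> - a" using ac by simp
  from half_line_competitor[OF k this Linfty_uminus[OF V(1)] _ H1_deriv_uminus[OF u]]
  obtain v2 h2 where 2: "v2 \<in> borel_measurable lborel" "h2 \<in> borel_measurable lborel"
    "v2 (- a) = 1" "\<And>x. cmod (v2 x) \<le> 1" "\<And>s t. s \<le> t \<Longrightarrow> (h2 has_integral v2 t - v2 s) {s..t}"
    "set_integrable lborel {..- a} (\<lambda>x. (cmod (v2 x))\<^sup>2)" "set_integrable lborel {..- a} (\<lambda>x. (cmod (h2 x))\<^sup>2)"
    "(LINT x:{..- a}|lborel. (cmod (h2 x))\<^sup>2 + V (- x) * (cmod (v2 x))\<^sup>2)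
       \<le> (LINT x:{..- a}|lborel. (cmod (- g (- x)))\<^sup>2 + V (- x) * (cmod (u (- x)))\<^sup>2)"
    using V(2) abc u1 by (auto)
  define v where "v = (\<lambda>x. if x \<le> a then v1 x else v2 (- x))"
  define h where "h = (\<lambda>x. if x \<le> a then h1 x else - h2 (- x))"
  note [measurable] = 1(1,2) 2(1,2)
  have meas[measurable]: "v \<in> borel_measurable lborel" "h \<in> borel_measurable lborel"
    unfolding v_def h_def by measurable
  have vh: "(h has_integral v t - v s) {s..t}" if "s \<le> t" for s t
    unfolding v_def h_def
    by (rule has_integral_glue[OF _ _ _ that]) (use 1 2 in \<open>auto intro!: has_integral_uminus_primitive\<close>)
  have refl: "set_integrable lborel {a..} (\<lambda>x. f (- x)) \<longleftrightarrow> set_integrable lborel {..- a} f" for f :: "real \<Rightarrow> real"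
  proof -
    have "(\<lambda>x. indicator {..- a} (- x) *\<^sub>R f (- x)) = (\<lambda>x. indicator {a..} x *\<^sub>R f (- x))"
      by (auto simp: indicator_def)
    then show ?thesis
      using integrable_lborel_uminus_iff[of "\<lambda>x. indicator {..- a} x *\<^sub>R f x"]
      by (simp add: set_integrable_def)
  qed
  have whole: "integrable lborel f"
    if "set_integrable lborel {..a} f1" "set_integrable lborel {..- a} f2"
      "\<And>x. f x = (if x \<le> a then f1 x else f2 (- x))" for f f1 f2 :: "real \<Rightarrow> real"
  proof -
    have "set_integrable lborel {..a} f"
      using that(1) by (rule set_integrable_cong[THEN iffD1, rotated -1]) (auto simp: that(3))
    moreover have "set_integrable lborel {a<..} f"
      using set_integrable_subset[OF that(2)[folded refl], of "{a<..}"]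
      by (rule set_integrable_cong[THEN iffD1, rotated -1]) (auto simp: that(3))
    ultimately have "set_integrable lborel ({..a} \<union> {a<..}) f"
      by (intro set_integrable_Un) auto
    also have "{..a} \<union> {a<..} = UNIV" by auto
    finally show ?thesis by (simp add: set_integrable_UNIV_iff)
  qed
  have v2: "integrable lborel (\<lambda>x. (cmod (v x))\<^sup>2)"
    by (rule whole[OF 1(6) 2(6)]) (simp add: v_def)
  have h2: "integrable lborel (\<lambda>x. (cmod (h x))\<^sup>2)"
    by (rule whole[OF 1(7) 2(7)]) (simp add: h_def)
  have vH1: "H1_deriv v h"
    using meas v2 h2 vh by (simp add: H1_deriv_def)
  have va: "v a = 1" using 1 by (simp add: v_def)
  have v1: "cmod (v x) \<le> 1" for x using 1 2 by (simp add: v_def)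
  have "supnorm v = 1"
    unfolding supnorm_def
    by (rule cSup_eq_maximum) (use va v1 in \<open>auto intro!: image_eqI[of _ _ a]\<close>)
  then have "v \<in> Kset a" using va vH1 by (auto simp: Kset_def H1_def)
  moreover
  \<comment> \<open>The right half is reflected to \<open>{..- a}\<close> to match the form of the
    estimate for \<open>v2\<close>. The identity serves both for the competitor and for
    \<open>u\<close>.\<close>
  have e_sum: "(LINT x|lborel. (cmod (g' x))\<^sup>2) + (LINT x|lborel. V x * (cmod (u' x))\<^sup>2)
      = (LINT x:{..a}|lborel. (cmod (g' x))\<^sup>2 + V x * (cmod (u' x))\<^sup>2)
      + (LINT x:{..- a}|lborel. (cmod (g' (- x)))\<^sup>2 + V (- x) * (cmod (u' (- x)))\<^sup>2)" if "H1_deriv u' g'" for u' g'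
  proof -
    have i: "integrable lborel (\<lambda>x. (cmod (g' x))\<^sup>2)" "integrable lborel (\<lambda>x. V x * (cmod (u' x))\<^sup>2)"
      using that set_integrable_Linfty_mult[OF V(1), of UNIV "\<lambda>x. (cmod (u' x))\<^sup>2"]
      by (auto simp: H1_deriv_def set_integrable_UNIV_iff)
    then have ei: "integrable lborel (\<lambda>x. (cmod (g' x))\<^sup>2 + V x * (cmod (u' x))\<^sup>2)" by simp
    have s: "{x. a \<le> - x} = {..- a}" by auto
    show "(LINT x|lborel. (cmod (g' x))\<^sup>2) + (LINT x|lborel. V x * (cmod (u' x))\<^sup>2)
      = (LINT x:{..a}|lborel. (cmod (g' x))\<^sup>2 + V x * (cmod (u' x))\<^sup>2)
      + (LINT x:{..- a}|lborel. (cmod (g' (- x)))\<^sup>2 + V (- x) * (cmod (u' (- x)))\<^sup>2)"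
      using integral_split_at[OF ei, of a] i
        set_integral_reflect[of "{a..}" "\<lambda>x. (cmod (g' x))\<^sup>2 + V x * (cmod (u' x))\<^sup>2"] by (simp add: s)
  qed
  have "(LINT x:{..a}|lborel. (cmod (h x))\<^sup>2 + V x * (cmod (v x))\<^sup>2) =
      (LINT x:{..a}|lborel. (cmod (h1 x))\<^sup>2 + V x * (cmod (v1 x))\<^sup>2)"
    by (rule set_lebesgue_integral_cong) (auto simp: v_def h_def)
  moreover have "(LINT x:{..- a}|lborel. (cmod (h (- x)))\<^sup>2 + V (- x) * (cmod (v (- x)))\<^sup>2) =
      (LINT x:{..- a}|lborel. (cmod (h2 x))\<^sup>2 + V (- x) * (cmod (v2 x))\<^sup>2)"
  \<comment> \<open>At \<open>- a\<close> the left-hand side uses \<open>h1 a\<close> instead of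
    \<open>h2 (- a)\<close>, so the integrands agree only almost everywhere.\<close>
  proof (rule set_lebesgue_integral_cong_AE)
    have [measurable]: "V \<in> borel_measurable lborel" using V by (simp add: Linfty_def)
    show "(\<lambda>x. (cmod (h (- x)))\<^sup>2 + V (- x) * (cmod (v (- x)))\<^sup>2) \<in> borel_measurable lborel"
      "(\<lambda>x. (cmod (h2 x))\<^sup>2 + V (- x) * (cmod (v2 x))\<^sup>2) \<in> borel_measurable lborel" by measurable
    show "AE x\<in>{..- a} in lborel. (cmod (h (- x)))\<^sup>2 + V (- x) * (cmod (v (- x)))\<^sup>2 =
        (cmod (h2 x))\<^sup>2 + V (- x) * (cmod (v2 x))\<^sup>2"
      using AE_lborel_singleton[of "- a"] by eventually_elim (auto simp: v_def h_def)
  qed auto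
  ultimately show thesis
    using 1(8) 2(8) by (intro that[of v]) (simp_all add: Ifun_eq[OF vH1] e_sum[OF vH1] e_sum[OF u])
qed

section \<open>Finiteness of the supremum norm and of the infima\<close>

text \<open>Needed because \<open>supnorm\<close> is a real-valued \<open>SUP\<close>, an upper
  bound only for bounded functions. By \<open>cmod (g z) \<le> 1 + (cmod (g z))\<^sup>2\<close>, the
  oscillation of \<open>u\<close> on intervals of length at most 1 is bounded by one constant
  \<open>G\<close>; square integrability of \<open>u\<close> then controls its size.\<close>

lemma H1_deriv_bounded:
  assumes "H1_deriv u g"
  obtains B where "\<And>x. cmod (u x) \<le> B"
proof -
  have [measurable]: "u \<in> borel_measurable lborel" "g \<in> borel_measurable lborel"
    and u2: "integrable lborel (\<lambda>x. (cmod (u x))\<^sup>2)" and g2: "integrable lborel (\<lambda>x. (cmod (g x))\<^sup>2)"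
    using assms by (auto simp: H1_deriv_def)
  define G where "G = 1 + (LINT x|lborel. (cmod (g x))\<^sup>2)"
  have ind: "integrable lborel (indicator {s..t} :: real \<Rightarrow> real)" for s t
    by (intro integrable_real_indicator) (auto simp: emeasure_lborel_Icc_eq)
  have inc: "cmod (u x - u y) \<le> G" if "y \<le> x" "x \<le> y + 1" for x y
  proof -
    have si: "set_integrable lborel {y..x} g" "(LINT x:{y..x}|lborel. g x) = u x - u y"
      using H1_deriv_set_integral[OF assms that(1)] by auto
    then have "cmod (u x - u y) \<le> (LINT z|lborel. norm (indicator {y..x} z *\<^sub>R g z))"
      unfolding set_lebesgue_integral_def by (metis integral_norm_bound)
    also have "\<dots> \<le> (LINT z|lborel. indicator {y..x} z + (cmod (g z))\<^sup>2)"
    proof (rule integral_mono)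
      show "integrable lborel (\<lambda>z. norm (indicator {y..x} z *\<^sub>R g z))"
        using si(1) unfolding set_integrable_def by (rule integrable_norm)
      show "integrable lborel (\<lambda>z. indicator {y..x} z + (cmod (g z))\<^sup>2)"
        using ind g2 by simp
      show "norm (indicator {y..x} z *\<^sub>R g z) \<le> indicator {y..x} z + (cmod (g z))\<^sup>2" for z
        using sum_squares_bound[of "cmod (g z)" 1] norm_ge_zero[of "g z"] by (auto simp: indicator_def simp del: norm_ge_zero)
    qed
    also have "\<dots> = (x - y) + (LINT x|lborel. (cmod (g x))\<^sup>2)"
      using ind g2 that by simp
    finally show ?thesis using that by (simp add: G_def)
  qed
  define B where "B = 2 * (LINT x|lborel. (cmod (u x))\<^sup>2) + 2 * G\<^sup>2"
  have "(cmod (u y))\<^sup>2 \<le> B" for y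
  proof -
    \<comment> \<open>Averaging \<open>(cmod (u y))\<^sup>2 \<le> 2 * (cmod (u x))\<^sup>2 + 2 *
      G\<^sup>2\<close> over \<open>x\<close> in a unit interval gives a bound independent of
      \<open>y\<close>.\<close>
    have "(LINT x|lborel. indicator {y..y+1} x * ((cmod (u y))\<^sup>2 - 2 * G\<^sup>2)) \<le> (LINT x|lborel. 2 * (cmod (u x))\<^sup>2)"
    proof (rule integral_mono)
      show "integrable lborel (\<lambda>x. indicator {y..y+1} x * ((cmod (u y))\<^sup>2 - 2 * G\<^sup>2))"
        by (intro integrable_mult_left ind)
      show "indicator {y..y+1} x * ((cmod (u y))\<^sup>2 - 2 * G\<^sup>2) \<le> 2 * (cmod (u x))\<^sup>2" for x
      proof (cases "x \<in> {y..y+1}")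
        case True
        have "cmod (u y) \<le> cmod (u x) + G"
          using inc[of y x] True norm_triangle_ineq2[of "u y" "u x"] by (simp add: norm_minus_commute)
        then have "(cmod (u y))\<^sup>2 \<le> (cmod (u x) + G)\<^sup>2" by (intro power_mono) auto
        also have "\<dots> \<le> 2 * (cmod (u x))\<^sup>2 + 2 * G\<^sup>2"
          using sum_squares_bound[of "cmod (u x)" G] by (simp add: power2_sum)
        finally show ?thesis using True by simp
      qed simp
    qed (use u2 in simp)
    then show ?thesis by (simp add: B_def)
  qed
  then have "cmod (u y) \<le> sqrt B" for y by (simp add: real_le_rsqrt)
  then show thesis by (rule that)
qed

text \<open>A crude bound, enough to make the real infima genuine lower bounds: the derivative term
  is dropped and \<open>V\<close> is negative essentially only between \<open>b\<close> and
  \<open>c\<close>.\<close>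

lemma Ifun_lower_bound:
  assumes V: "V \<in> Linfty" and outside: "AE x in lborel. x \<in> {..<b} \<union> {c<..} \<longrightarrow> 0 \<le> V x"
    and inside: "\<And>x. x \<in> {b<..<c} \<Longrightarrow> V x = - K" and "0 \<le> K" "b \<le> c"
    and u: "H1_deriv u g" and s: "\<And>x. cmod (u x) \<le> s"
  shows "- (K * (c - b)) * s\<^sup>2 \<le> Ifun u V"
proof -
  have ind: "integrable lborel (indicator {b..c} :: real \<Rightarrow> real)"
    by (intro integrable_real_indicator) (auto simp: emeasure_lborel_Icc_eq)
  have "- (K * (c - b)) * s\<^sup>2 = (LINT x|lborel. indicator {b..c} x * (- K * s\<^sup>2))"
    using \<open>b \<le> c\<close> by simp
  also have "\<dots> \<le> (LINT x|lborel. V x * (cmod (u x))\<^sup>2)"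
  proof (rule integral_mono_AE)
    show "integrable lborel (\<lambda>x. indicator {b..c} x * (- K * s\<^sup>2))"
      by (intro integrable_mult_left ind)
    show "integrable lborel (\<lambda>x. V x * (cmod (u x))\<^sup>2)"
      using u set_integrable_Linfty_mult[OF V, of UNIV "\<lambda>x. (cmod (u x))\<^sup>2"]
      by (auto simp: H1_deriv_def set_integrable_UNIV_iff)
    show "AE x in lborel. indicator {b..c} x * (- K * s\<^sup>2) \<le> V x * (cmod (u x))\<^sup>2"
      using outside AE_lborel_singleton[of b] AE_lborel_singleton[of c]
    proof eventually_elim
      fix x assume x: "x \<in> {..<b} \<union> {c<..} \<longrightarrow> 0 \<le> V x" "x \<noteq> b" "x \<noteq> c"
      show "indicator {b..c} x * (- K * s\<^sup>2) \<le> V x * (cmod (u x))\<^sup>2"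
      proof (cases "x \<in> {b<..<c}")
        case True
        have "(cmod (u x))\<^sup>2 \<le> s\<^sup>2" using s by (intro power_mono) auto
        then show ?thesis using True inside \<open>0 \<le> K\<close> by (simp add: mult_left_mono)
      next
        case False
        then show ?thesis using x by (auto simp: indicator_def)
      qed
    qed
  qed
  also have "\<dots> \<le> Ifun u V" by (simp add: Ifun_eq[OF u])
  finally show ?thesis .
qed

lemma cmod_le_supnorm:
  assumes "u \<in> H1"
  shows "cmod (u x) \<le> supnorm u"
proof -
  obtain g B where "H1_deriv u g" "\<And>x. cmod (u x) \<le> B"
    using assms H1_deriv_bounded unfolding H1_def by blast
  then show ?thesis unfolding supnorm_def by (intro cSUP_upper bdd_aboveI2[of _ _ B]) auto
qed

lemma H1_deriv_divide:
  assumes "H1_deriv u g"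
  shows "H1_deriv (\<lambda>x. u x / of_real s) (\<lambda>x. g x / of_real s)"
  using assms has_integral_divide[of g _ _ "of_real s"]
  by (auto simp: H1_deriv_def norm_divide power_divide simp flip: diff_divide_distrib)

section \<open>Comparison of the two infima\<close>

theorem theorem5p6:
  fixes \<alpha> \<beta> b c :: real and V :: "real \<Rightarrow> real"
  assumes "\<alpha> > 0" and "\<beta> > 0" and "b < c"
    and "V \<in> Linfty"
    and "AE x in lborel. x \<in> {..<b} \<union> {c<..} \<longrightarrow> V x \<ge> \<alpha>"
    and "\<forall>x \<in> {b<..<c}. V x = - \<beta>"
    and "sqrt \<beta> * (c - b) \<ge> pi"
  shows "\<exists>a \<in> {b..c}. Ffun a V = mV V"
proof
  define a where "a = (b + c) / 2"
  show "a \<in> {b..c}" using \<open>b < c\<close> by (simp add: a_def)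
  define k where "k = sqrt \<beta>"
  have k: "0 < k" "k\<^sup>2 = \<beta>" using \<open>\<beta> > 0\<close> by (auto simp: k_def)
  \<comment> \<open>The hypothesis on the width of the well enters here: each half of
    \<open>{b..c}\<close> has room for a quarter wave of length \<open>pi / (2 * k)\<close>.\<close>
  have "pi / k \<le> c - b" using assms(7) k(1) by (simp add: k_def field_simps)
  then have ba: "b + pi / (2 * k) \<le> a" and ac: "a + pi / (2 * k) \<le> c"
    by (auto simp: a_def field_simps)
  have competitor: "\<exists>v\<in>Kset a. Ifun v V \<le> (LINT x|lborel. (cmod (g x))\<^sup>2) + (LINT x|lborel. V x * (cmod (u x))\<^sup>2)"
    if "H1_deriv u g" "\<And>x. cmod (u x) \<le> 1" for u g
    using competitor_in_Kset[OF k(1) ba ac \<open>V \<in> Linfty\<close> _ that] assms(6) k(2) by (metis (no_types, lifting))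
  have lower: "- (\<beta> * (c - b)) * (supnorm u)\<^sup>2 \<le> Ifun u V" if u: "u \<in> H1" for u
  proof -
    obtain g where g: "H1_deriv u g" using u by (auto simp: H1_def)
    show ?thesis
    proof (rule Ifun_lower_bound[OF \<open>V \<in> Linfty\<close> _ _ _ _ g cmod_le_supnorm[OF u]])
      show "AE x in lborel. x \<in> {..<b} \<union> {c<..} \<longrightarrow> 0 \<le> V x"
        using assms(5) by eventually_elim (use \<open>\<alpha> > 0\<close> in auto)
    qed (use assms in auto)
  qed
  define X where "X = {u \<in> H1. u \<noteq> (\<lambda>_. 0)}"
  have KX: "Kset a \<subseteq> X" by (auto simp: Kset_def X_def)
  have bddF: "bdd_below ((\<lambda>u. Ifun u V) ` Kset a)"
    using lower by (intro bdd_belowI2[of _ "- (\<beta> * (c - b))"]) (fastforce simp: Kset_def)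
  have pos: "supnorm u > 0" if "u \<in> X" for u
  proof -
    obtain x where "u x \<noteq> 0" using \<open>u \<in> X\<close> by (auto simp: X_def)
    then have "0 < cmod (u x)" by simp
    also have "\<dots> \<le> supnorm u" using that by (intro cmod_le_supnorm) (auto simp: X_def)
    finally show ?thesis .
  qed
  have bddm: "bdd_below ((\<lambda>u. Ifun u V / (supnorm u)\<^sup>2) ` X)"
  proof (rule bdd_belowI2)
    fix u assume "u \<in> X"
    then show "- (\<beta> * (c - b)) \<le> Ifun u V / (supnorm u)\<^sup>2"
      using lower[of u] pos[of u] by (simp add: X_def pos_le_divide_eq)
  qed
  \<comment> \<open>The competitor construction accepts any \<open>u\<close> with modulus at most 1;
    applied to the zero function, it shows that \<open>Kset a\<close> is non-empty.\<close>
  have "H1_deriv (\<lambda>_. 0) (\<lambda>_. 0)" by (simp add: H1_deriv_def)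
  from competitor[OF this] have "Kset a \<noteq> {}" by auto
  have "mV V \<le> Ffun a V"
    unfolding Ffun_def
  proof (rule cINF_greatest[OF \<open>Kset a \<noteq> {}\<close>])
    fix u assume u: "u \<in> Kset a"
    \<comment> \<open>On \<open>Kset a\<close> the supremum norm is 1, so the quotient is
      \<open>Ifun u V\<close> itself.\<close>
    then have "mV V \<le> Ifun u V / (supnorm u)\<^sup>2"
      unfolding mV_def X_def[symmetric] using KX by (intro cINF_lower bddm) auto
    then show "mV V \<le> Ifun u V" using u by (simp add: Kset_def)
  qed
  moreover have "Ffun a V \<le> mV V"
    unfolding mV_def X_def[symmetric]
  proof (rule cINF_greatest)
    show "X \<noteq> {}" using KX \<open>Kset a \<noteq> {}\<close> by auto
    fix u assume u: "u \<in> X"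
    then obtain g where g: "H1_deriv u g" by (auto simp: X_def H1_def)
    define s where "s = supnorm u"
    have s: "s > 0" "\<And>x. cmod (u x) \<le> s"
      using pos[OF u] cmod_le_supnorm u by (auto simp: s_def X_def)
    \<comment> \<open>Dividing by \<open>s\<close> brings the modulus down to at most 1. The energy
      is quadratic, so that of the scaled function is exactly the quotient
      \<open>Ifun u V / s\<^sup>2\<close>.\<close>
    obtain v where v: "v \<in> Kset a" "Ifun v V \<le> (LINT x|lborel. (cmod (g x / of_real s))\<^sup>2)
        + (LINT x|lborel. V x * (cmod (u x / of_real s))\<^sup>2)"
      using competitor[OF H1_deriv_divide[OF g, of s]] s by (auto simp: norm_divide)
    have "Ffun a V \<le> Ifun v V"
      unfolding Ffun_def using v by (intro cINF_lower bddF)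
    also have "\<dots> \<le> Ifun u V / s\<^sup>2"
      using v(2) by (simp add: Ifun_eq[OF g] norm_divide power_divide add_divide_distrib)
    finally show "Ffun a V \<le> Ifun u V / (supnorm u)\<^sup>2" by (simp add: s_def)
  qed
  ultimately show "Ffun a V = mV V" by simp
qed

end
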